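(* There exist absolute constants $c_1,c_2>0$ such that for all positive integers $n$ and $k$, there exists a $(c_1k/n)^k$-biased distribution $D$ on $\{-1,1\}^n$ such that $\sum_{i=1}^n D_i$ takes at most $c_2k^2$ distinct values and $\big|\sum_{i=1}^n D_i\big|\le 21\sqrt{kn}$ with probability $1$.
   Context: For a distribution $D$ on $\{-1,1\}^n$, $D$ is $\varepsilon$-biased if for every nonempty $S\subseteq[n]$, $|\mathbb{E}[\prod_{i\in S}D_i]|\le\varepsilon$. *)

theory Defs
  imports "HOL-Probability.Probability"
begin

text \<open>The dimension is quantified inside the theorem, after the absolute constants, so it
  cannot be a type; \<open>{-1,1}^n\<close> is a set of extensional functions on \<open>{1..n}\<close>.\<close>

definition cube :: "nat \<Rightarrow> (nat \<Rightarrow> real) set" where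
  "cube n = {1..n} \<rightarrow>\<^sub>E {-1, 1}"

definition distribution_on_cube :: "nat \<Rightarrow> (nat \<Rightarrow> real) pmf \<Rightarrow> bool" where
  "distribution_on_cube n D \<longleftrightarrow> set_pmf D \<subseteq> cube n"

definition biased :: "nat \<Rightarrow> real \<Rightarrow> (nat \<Rightarrow> real) pmf \<Rightarrow> bool" where
  "biased n \<epsilon> D \<longleftrightarrow>
    (\<forall>S. S \<subseteq> {1..n} \<and> S \<noteq> {} \<longrightarrow>
      \<bar>measure_pmf.expectation D (\<lambda>x. \<Prod>i\<in>S. x i)\<bar> \<le> \<epsilon>)"

end

theory Submission
  imports Defs "HOL-Computational_Algebra.Polynomial"
begin

text \<open>An exchangeable distribution that puts weight \<open>p\<^sub>j\<close> on the vectors with \<open>j\<close> entries \<open>-1\<close> has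
  Fourier coefficient \<open>\<Sum>\<^sub>j p\<^sub>j K\<^sub>s(j) / (n choose s)\<close> at every set of size \<open>s\<close>, where \<open>K\<^sub>s\<close> is the
  Krawtchouk polynomial. Supporting \<open>p\<close> on the window \<open>|n - 2j| \<le> 21 * sqrt (k * n)\<close> makes the
  coefficients with \<open>2k < s < n - 2k\<close> at most \<open>(c\<^sub>1 k / n)^k\<close> by pointwise bounds on \<open>K\<^sub>s\<close>. The
  remaining \<open>O(k)\<close> coefficients are made exactly zero: the binomial weights, truncated to the
  window, satisfy these linear conditions up to an error \<open>exp (- 64 k)\<close>, which a small
  multiplicative correction removes. Finally a Caratheodory argument reduces the support of \<open>p\<close> to
  the number \<open>O(k)\<close> of linear conditions.\<close>

subsection \<open>Krawtchouk polynomials\<close>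

text \<open>The generating-function form of \<open>K_s(j)\<close>, meant for
  \<open>j \<le> n\<close>. It turns size bounds into coefficient bounds for a product of linear
  factors.\<close>

definition kraw :: "nat \<Rightarrow> nat \<Rightarrow> nat \<Rightarrow> real" where
  "kraw n s j = coeff ([:1, -1:] ^ j * [:1, 1:] ^ (n - j)) s"

lemma prod_if_neg_one:
  assumes "finite A"
  shows "(\<Prod>i\<in>A. if i \<in> X then - 1 else 1) = ((- 1) ^ card (A \<inter> X) :: real)"
  using assms by (simp add: prod.If_cases)

text \<open>Both sides are the coefficient of \<open>z^s\<close> in the product over
  \<open>A\<close> of the factors \<open>1 - z\<close> on \<open>X\<close> and \<open>1 + z\<close>
  off \<open>X\<close>. Expanding the product, the choice of the nonconstant terms at
  \<open>S\<close> contributes the character value times \<open>z^(card S)\<close>.\<close>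

lemma sum_character_card:
  assumes "finite A" "X \<subseteq> A"
  shows "(\<Sum>S | S \<subseteq> A \<and> card S = s. (- 1) ^ card (S \<inter> X)) = kraw (card A) s (card X)"
proof -
  define f :: "'a \<Rightarrow> real poly" where "f i = monom (if i \<in> X then - 1 else 1) 1" for i
  have fS: "(\<Prod>i\<in>S. f i) = monom ((- 1) ^ card (S \<inter> X)) (card S)" if "S \<subseteq> A" for S
  proof -
    have fin: "finite S" using that assms finite_subset by blast
    have "(\<Prod>i\<in>S. f i) = monom (\<Prod>i\<in>S. if i \<in> X then - 1 else 1) (card S)"
      using fin by induction (auto simp: f_def mult_monom monom_0)
    then show ?thesis by (simp add: prod_if_neg_one[OF fin])
  qed
  have f1: "f i + 1 = (if i \<in> X then [:1, -1:] else [:1, 1:])" for i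
    unfolding f_def one_pCons by (simp add: monom_Suc monom_0)
  have "(\<Prod>i\<in>A. f i + 1) = [:1, -1:] ^ card X * [:1, 1:] ^ (card A - card X)"
  proof -
    have "(\<Prod>i\<in>A. f i + 1) = [:1, -1:] ^ card (A \<inter> X) * [:1, 1:] ^ card (A - X)"
      unfolding f1 using assms(1)
      by (subst prod.If_cases) (auto simp: Diff_eq)
    also have "A \<inter> X = X" using assms by blast
    also have "card (A - X) = card A - card X"
      using assms finite_subset by (intro card_Diff_subset) auto
    finally show ?thesis .
  qed
  moreover have "(\<Prod>i\<in>A. f i + 1) = (\<Sum>S\<in>Pow A. monom ((- 1) ^ card (S \<inter> X)) (card S))"
    using fS by (simp add: prod_add[OF assms(1)])
  ultimately have "kraw (card A) s (card X)
      = coeff (\<Sum>S\<in>Pow A. monom ((- 1) ^ card (S \<inter> X)) (card S)) s"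
    by (simp add: kraw_def)
  also have "\<dots> = (\<Sum>S\<in>Pow A. if card S = s then (- 1) ^ card (S \<inter> X) else 0)"
    by (simp add: coeff_sum)
  also have "\<dots> = (\<Sum>S | S \<subseteq> A \<and> card S = s. (- 1) ^ card (S \<inter> X))"
    using assms(1) by (simp add: sum.If_cases Int_def)
  finally show ?thesis by simp
qed

section \<open>Orthogonality and symmetries of Krawtchouk polynomials\<close>

lemma sum_Pow_group_card:
  fixes g :: "'a set \<Rightarrow> real"
  assumes "finite A"
  shows "(\<Sum>X\<in>Pow A. g X) = (\<Sum>j\<le>card A. \<Sum>X | X \<subseteq> A \<and> card X = j. g X)"
proof -
  have "(\<Sum>X\<in>Pow A. g X) = (\<Sum>j\<le>card A. \<Sum>X | X \<in> Pow A \<and> card X = j. g X)"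
    using assms by (subst sum.group) (auto intro: card_mono)
  then show ?thesis by simp
qed

lemma sum_Pow_by_card:
  fixes f :: "nat \<Rightarrow> real"
  assumes "finite A"
  shows "(\<Sum>X\<in>Pow A. f (card X)) = (\<Sum>j\<le>card A. real (card A choose j) * f j)"
  unfolding sum_Pow_group_card[OF assms]
  using assms by (intro sum.cong) (simp_all add: n_subsets)

text \<open>The product of two characters is multiplicative over the elements of \<open>X\<close>,
  so the sum over \<open>X\<close> factors as a product of \<open>h i + 1\<close>. Any
  \<open>i\<close> in exactly one of \<open>S\<close>, \<open>S'\<close> gives the factor 0.\<close>

lemma sum_character_orthogonal:
  assumes "finite A" "S \<subseteq> A" "S' \<subseteq> A"
  shows "(\<Sum>X\<in>Pow A. (- 1) ^ card (S \<inter> X) * (- 1) ^ card (S' \<inter> X))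
    = (if S = S' then 2 ^ card A else (0::real))"
proof -
  define h :: "'a \<Rightarrow> real" where
    "h i = (if i \<in> S then - 1 else 1) * (if i \<in> S' then - 1 else 1)" for i
  have "(\<Sum>X\<in>Pow A. (- 1) ^ card (S \<inter> X) * (- 1) ^ card (S' \<inter> X)) = (\<Sum>X\<in>Pow A. \<Prod>i\<in>X. h i)"
  proof (rule sum.cong)
    fix X assume "X \<in> Pow A"
    then have "finite X" using assms finite_subset by auto
    then show "(- 1) ^ card (S \<inter> X) * (- 1) ^ card (S' \<inter> X) = (\<Prod>i\<in>X. h i)"
      unfolding h_def prod.distrib by (simp add: prod_if_neg_one Int_commute)
  qed simp
  also have "\<dots> = (\<Prod>i\<in>A. h i + 1)"
    using prod_add[OF assms(1), of h "\<lambda>_. 1"] by simp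
  also have "\<dots> = (if S = S' then 2 ^ card A else 0)"
  proof (cases "S = S'")
    case True
    then have "h i + 1 = 2" for i by (simp add: h_def)
    then show ?thesis using True by simp
  next
    case False
    then obtain i where "i \<in> A" "i \<in> S \<longleftrightarrow> i \<notin> S'" using assms by blast
    then have "i \<in> A" "h i + 1 = 0" by (auto simp: h_def)
    then have "(\<Prod>i\<in>A. h i + 1) = 0" using assms(1) by (intro prod_zero) auto
    then show ?thesis using False by simp
  qed
  finally show ?thesis .
qed

text \<open>The binomial weight counts the sets \<open>X\<close> of size \<open>j\<close>. Expanding
  both Krawtchouk values into characters, only the pairs \<open>S = S'\<close> survive.\<close>

lemma kraw_orthogonal:
  "(\<Sum>j\<le>n. real (n choose j) * (kraw n s j * kraw n t j))
    = (if s = t then 2 ^ n * real (n choose s) else 0)"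
proof -
  define A where "A = {1..n}"
  have A: "finite A" "card A = n" by (auto simp: A_def)
  let ?B = "\<lambda>s. {S. S \<subseteq> A \<and> card S = s}"
  have fB: "finite (?B s)" for s using A(1) by simp
  have "(\<Sum>j\<le>n. real (n choose j) * (kraw n s j * kraw n t j))
      = (\<Sum>X\<in>Pow A. kraw n s (card X) * kraw n t (card X))"
    using sum_Pow_by_card[OF A(1), of "\<lambda>j. kraw n s j * kraw n t j"] A(2) by simp
  also have "\<dots> = (\<Sum>X\<in>Pow A. \<Sum>S\<in>?B s. \<Sum>S'\<in>?B t. (- 1) ^ card (S \<inter> X) * (- 1) ^ card (S' \<inter> X))"
  proof (rule sum.cong)
    fix X assume "X \<in> Pow A"
    then have "kraw n s (card X) = (\<Sum>S\<in>?B s. (- 1) ^ card (S \<inter> X))" for s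
      using sum_character_card[OF A(1), of X s] A(2) by simp
    then show "kraw n s (card X) * kraw n t (card X)
        = (\<Sum>S\<in>?B s. \<Sum>S'\<in>?B t. (- 1) ^ card (S \<inter> X) * (- 1) ^ card (S' \<inter> X))"
      by (simp only: sum_product)
  qed simp
  also have "\<dots> = (\<Sum>S\<in>?B s. \<Sum>S'\<in>?B t. \<Sum>X\<in>Pow A. (- 1) ^ card (S \<inter> X) * (- 1) ^ card (S' \<inter> X))"
    by (subst sum.swap, rule sum.cong, simp, rule sum.swap)
  also have "\<dots> = (\<Sum>S\<in>?B s. \<Sum>S'\<in>?B t. if S = S' then 2 ^ n else 0)"
    using A by (intro sum.cong) (auto simp: sum_character_orthogonal)
  also have "\<dots> = (\<Sum>S\<in>?B s. if S \<in> ?B t then 2 ^ n else 0)"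
    using fB by (intro sum.cong) auto
  also have "\<dots> = (if s = t then 2 ^ n * real (n choose s) else 0)"
  proof (cases "s = t")
    case True
    have "(\<Sum>S\<in>?B s. if S \<in> ?B t then 2 ^ n else (0::real)) = (\<Sum>S\<in>?B s. 2 ^ n)"
      using True by (intro sum.cong) auto
    then show ?thesis using True A by (simp add: n_subsets)
  next
    case False
    then show ?thesis by (auto intro: sum.neutral)
  qed
  finally show ?thesis .
qed

text \<open>Double counting: both sides sum \<open>(-1)^card (X \<inter> S)\<close> over all pairs
  with \<open>card S = s\<close> and \<open>card X = j\<close>, an expression symmetric in
  \<open>S\<close> and \<open>X\<close>.\<close>

lemma kraw_reciprocity:
  "real (n choose s) * kraw n j s = real (n choose j) * kraw n s j"
proof -
  define A where "A = {1..n}"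
  have A: "finite A" "card A = n" by (auto simp: A_def)
  have "real (n choose s) * kraw n j s
      = (\<Sum>S | S \<subseteq> A \<and> card S = s. \<Sum>X | X \<subseteq> A \<and> card X = j. (- 1) ^ card (X \<inter> S))" for s j
    using A by (simp add: sum_character_card n_subsets)
  from this[of s j] this[of j s] show ?thesis
    by (subst (asm) sum.swap) (simp add: Int_commute)
qed

text \<open>Complementing \<open>S\<close> multiplies its character at \<open>X\<close> by the fixed
  sign \<open>(-1)^(card X)\<close>. This reduces levels above \<open>n / 2\<close> to levels
  below.\<close>

lemma abs_kraw_complement:
  assumes "s \<le> n" "j \<le> n"
  shows "\<bar>kraw n (n - s) j\<bar> = \<bar>kraw n s j\<bar>"
proof -
  define A where "A = {1..n}"
  have A: "finite A" "card A = n" by (auto simp: A_def)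
  obtain X where X: "X \<subseteq> A" "card X = j"
    using A assms by (meson obtain_subset_with_card_n)
  have eq: "(- 1) ^ card ((A - S) \<inter> X) = (- 1) ^ j * ((- 1) ^ card (S \<inter> X) :: real)"
    if "S \<subseteq> A" for S
  proof -
    have "card X = card ((A - S) \<inter> X \<union> S \<inter> X)"
      using X by (intro arg_cong[where f = card]) blast
    also have "\<dots> = card ((A - S) \<inter> X) + card (S \<inter> X)"
      using A X finite_subset by (intro card_Un_disjoint) auto
    finally show ?thesis using X by (simp add: power_add)
  qed
  have "kraw n (n - s) j = (\<Sum>S | S \<subseteq> A \<and> card S = n - s. (- 1) ^ card (S \<inter> X))"
    using sum_character_card[OF A(1) X(1), of "n - s"] A X by simp
  also have "\<dots> = (\<Sum>S | S \<subseteq> A \<and> card S = s. (- 1) ^ card ((A - S) \<inter> X))"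
    using A assms
    by (intro sum.reindex_bij_witness[of _ "\<lambda>S. A - S" "\<lambda>S. A - S"])
      (auto simp: double_diff card_Diff_subset finite_subset[of _ A])
  also have "\<dots> = (- 1) ^ j * kraw n s j"
    using sum_character_card[OF A(1) X(1), of s] A X eq by (simp flip: sum_distrib_left)
  finally show ?thesis by (simp add: abs_mult power_abs)
qed

lemma kraw_0 [simp]: "kraw n 0 j = 1"
  by (simp add: kraw_def flip: poly_0_coeff_0)

section \<open>Pointwise bounds by coefficient majorization\<close>

lemma coeff_mult_majorized:
  fixes p q p' q' :: "real poly"
  assumes "\<And>i. \<bar>coeff p i\<bar> \<le> coeff q i" "\<And>i. \<bar>coeff p' i\<bar> \<le> coeff q' i"
  shows "\<bar>coeff (p * p') i\<bar> \<le> coeff (q * q') i"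
  unfolding coeff_mult using assms
  by (intro order_trans[OF sum_abs] sum_mono)
    (auto simp: abs_mult intro!: mult_mono intro: order_trans[OF abs_ge_zero])

lemma coeff_power_majorized:
  fixes p q :: "real poly"
  assumes "\<And>i. \<bar>coeff p i\<bar> \<le> coeff q i"
  shows "\<bar>coeff (p ^ m) i\<bar> \<le> coeff (q ^ m) i"
proof (induction m arbitrary: i)
  case (Suc m)
  show ?case unfolding power_Suc by (rule coeff_mult_majorized[OF assms Suc])
qed simp

lemma coeff_times_power_le_poly:
  fixes q :: "real poly"
  assumes "\<And>i. coeff q i \<ge> 0" "r \<ge> 0"
  shows "coeff q s * r ^ s \<le> poly q r"
proof (cases "s \<le> degree q")
  case True
  then show ?thesis unfolding poly_altdef using assms
    by (intro member_le_sum[of s _ "\<lambda>i. coeff q i * r ^ i"]) auto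
next
  case False
  then show ?thesis using assms by (simp add: coeff_eq_0 poly_altdef sum_nonneg)
qed

text \<open>Pairing \<open>(1 - z) * (1 + z) = 1 - z^2\<close> as often as possible leaves only
  \<open>|n - 2j|\<close> linear factors. Majorizing by \<open>1 + z^2\<close> and
  \<open>1 + z\<close> and evaluating at \<open>r\<close>, each pair costs only
  \<open>exp (r^2)\<close>, and a single coefficient is at most the value divided by
  \<open>r^s\<close>.\<close>

lemma abs_kraw_le:
  assumes "j \<le> n" "r > 0"
  shows "\<bar>kraw n s j\<bar> \<le> exp (real n * r\<^sup>2 / 2 + r * \<bar>real n - 2 * real j\<bar>) / r ^ s"
proof -
  \<comment> \<open>\<open>a\<close> counts the pairs and \<open>b = |n - 2j|\<close> the leftover
    factors, so \<open>2 * a + b = n\<close>; the sign \<open>c\<close> tells which kind of factor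
    is left over.\<close>
  have main: "\<bar>coeff ([:1, 0, -1:] ^ a * [:1, c:] ^ b) s\<bar> \<le> exp (real (2 * a + b) * r\<^sup>2 / 2 + r * real b) / r ^ s"
    if "\<bar>c\<bar> = 1" for a b :: nat and c :: real
  proof -
    let ?q = "[:1, 0, 1:] ^ a * [:1, 1:] ^ b :: real poly"
    have maj: "\<bar>coeff ([:1, 0, -1:] ^ a * [:1, c:] ^ b) i\<bar> \<le> coeff ?q i" for i
      using that
      by (intro coeff_mult_majorized coeff_power_majorized) (auto simp: coeff_pCons split: nat.split)
    have "\<bar>coeff ([:1, 0, -1:] ^ a * [:1, c:] ^ b) s\<bar> * r ^ s \<le> coeff ?q s * r ^ s"
      using maj assms by (intro mult_right_mono) auto
    also have "\<dots> \<le> poly ?q r"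
      using assms maj by (intro coeff_times_power_le_poly) (auto intro: order_trans[OF abs_ge_zero])
    also have "\<dots> = (1 + r\<^sup>2) ^ a * (1 + r) ^ b"
      by (simp add: power2_eq_square)
    also have "\<dots> \<le> exp (r\<^sup>2) ^ a * exp r ^ b"
      using assms by (intro mult_mono power_mono) auto
    also have "\<dots> = exp (real a * r\<^sup>2 + real b * r)"
      by (simp add: exp_add exp_of_nat_mult)
    also have "\<dots> \<le> exp (real (2 * a + b) * r\<^sup>2 / 2 + r * real b)"
      by (simp add: field_simps)
    finally show ?thesis using assms by (simp add: field_simps)
  qed
  have fac: "[:1, -1:] * [:1, 1:] = ([:1, 0, -1:] :: real poly)" by simp
  show ?thesis
  proof (cases "2 * j \<le> n")
    case True
    have "[:1, -1:] ^ j * [:1, 1:] ^ (n - j) = ([:1, -1:] ^ j * ([:1, 1:] ^ j * [:1, 1:] ^ (n - 2 * j)) :: real poly)"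
      using True by (simp flip: power_add)
    also have "\<dots> = [:1, 0, -1:] ^ j * [:1, 1:] ^ (n - 2 * j)"
      by (simp only: fac[symmetric] power_mult_distrib mult.assoc)
    finally show ?thesis using main[of 1 j "n - 2 * j"] True
      by (simp add: kraw_def)
  next
    case False
    have "[:1, -1:] ^ j * [:1, 1:] ^ (n - j) = ([:1, 1:] ^ (n - j) * ([:1, -1:] ^ (n - j) * [:1, -1:] ^ (2 * j - n)) :: real poly)"
      using False assms by (simp add: mult.commute flip: power_add)
    also have "\<dots> = [:1, 0, -1:] ^ (n - j) * [:1, -1:] ^ (2 * j - n)"
      by (simp only: fac[symmetric] power_mult_distrib mult_ac)
    finally show ?thesis using main[of "-1" "n - j" "2 * j - n"] False assms
      by (simp add: kraw_def)
  qed
qed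

section \<open>Bias bound for the middle levels\<close>

lemma binomial_square_lower_bound:
  assumes "1 \<le> s" "s \<le> n"
  shows "(real n * real (n - s)) ^ s * 4 ^ s \<le> (real (n choose s))\<^sup>2 * (real s + 1) ^ (2 * s)"
proof -
  \<comment> \<open>Pairing the factors with indices \<open>i\<close> and \<open>s - 1 - i\<close> improves the square of \<open>(n/s)^s \<le> n choose s\<close> by nearly \<open>(4 (n - s) / n)^s\<close>.\<close>
  have rev_index: "(\<Prod>i<s. f i) = (\<Prod>i<s. f (s - 1 - i) :: real)" for f
    by (rule prod.reindex_bij_witness[of _ "\<lambda>i. s - 1 - i" "\<lambda>i. s - 1 - i"]) auto
  have num: "fact s * real (n choose s) = (\<Prod>i<s. real n - real i)"
    by (simp add: binomial_gbinomial gbinomial_prod_rev atLeast0LessThan)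
  have "(real n * real (n - s)) ^ s = (\<Prod>i<s. real n * real (n - s))" by simp
  also have "\<dots> \<le> (\<Prod>i<s. (real n - real i) * (real n - real (s - 1 - i)))"
  proof (intro prod_mono conjI)
    fix i assume "i \<in> {..<s}"
    then obtain l where l: "s = i + l + 1" by (metis add.commute less_iff_Suc_add lessThan_iff plus_1_eq_Suc)
    obtain m where m: "n = s + m" using assms le_Suc_ex by blast
    \<comment> \<open>With \<open>i + l = s - 1\<close> the right side equals
      \<open>n * (n - s + 1) + i * l\<close>.\<close>
    show "real n * real (n - s) \<le> (real n - real i) * (real n - real (s - 1 - i))"
      by (simp add: l m algebra_simps)
  qed simp
  also have "\<dots> = (fact s * real (n choose s))\<^sup>2"
    unfolding prod.distrib power2_eq_square num by (simp only: rev_index[of "\<lambda>i. real n - real i", symmetric])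
  finally have 1: "(real n * real (n - s)) ^ s \<le> (fact s)\<^sup>2 * (real (n choose s))\<^sup>2"
    by (simp add: power_mult_distrib)
  have "fact s = (\<Prod>i<s. real (Suc i))"
    by (simp add: fact_prod_Suc atLeast0LessThan)
  then have "(fact s :: real)\<^sup>2 = (\<Prod>i<s. real (Suc i) * real (Suc (s - 1 - i)))"
    unfolding prod.distrib power2_eq_square by (simp only: rev_index[of "\<lambda>i. real (Suc i)", symmetric])
  also have "\<dots> \<le> (\<Prod>i<s. (real s + 1)\<^sup>2 / 4)"
  proof (intro prod_mono conjI)
    fix i assume "i \<in> {..<s}"
    then obtain l where l: "s = i + l + 1" by (metis add.commute less_iff_Suc_add lessThan_iff plus_1_eq_Suc)
    have "4 * ((1 + real i) * (1 + real l)) \<le> ((1 + real i) + (1 + real l))\<^sup>2"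
      using zero_le_power2[of "real i - real l"] by (simp add: power2_eq_square algebra_simps)
    then show "real (Suc i) * real (Suc (s - 1 - i)) \<le> (real s + 1)\<^sup>2 / 4"
      by (simp add: l add_ac)
  qed simp
  also have "\<dots> = (real s + 1) ^ (2 * s) / 4 ^ s" by (simp add: power_divide flip: power_mult)
  finally have 2: "(fact s)\<^sup>2 * 4 ^ s \<le> (real s + 1) ^ (2 * s)" by (simp add: field_simps)
  have "(real n * real (n - s)) ^ s * 4 ^ s \<le> (fact s)\<^sup>2 * (real (n choose s))\<^sup>2 * 4 ^ s"
    using 1 by (intro mult_right_mono) auto
  also have "\<dots> = (real (n choose s))\<^sup>2 * ((fact s)\<^sup>2 * 4 ^ s)" by simp
  also have "\<dots> \<le> (real (n choose s))\<^sup>2 * (real s + 1) ^ (2 * s)"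
    using 2 by (intro mult_left_mono) auto
  finally show ?thesis .
qed

text \<open>The bound on \<open>K_s\<close> at a suitable radius is divided by the squared binomial
  bound. The 2 in the base \<open>s / (2 * n)\<close> is essential: at \<open>s = n / 2\<close> it
  is what beats the factor \<open>exp s\<close>.\<close>

lemma normalized_kraw_square_le:
  assumes s: "1 \<le> s" "2 * s \<le> n" and j: "j \<le> n" and t: "\<bar>real n - 2 * real j\<bar> \<le> 21 * sqrt (real k * real n)"
  shows "(kraw n s j / real (n choose s))\<^sup>2
    \<le> (real s / (2 * real n)) ^ s * exp (2 + real s + 42 * sqrt (real k * real s))"
proof -
  have n: "n > 0" using s by auto
  \<comment> \<open>This radius minimizes \<open>exp (n * r^2 / 2) / r^s\<close>.\<close>
  define r where "r = sqrt (real s / real n)"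
  have r: "r > 0" "r\<^sup>2 = real s / real n" using s n by (auto simp: r_def)
  have "r * \<bar>real n - 2 * real j\<bar> \<le> r * (21 * sqrt (real k * real n))"
    using t r by (intro mult_left_mono) auto
  also have "\<dots> = 21 * sqrt (real k * real s)"
    using n by (simp add: r_def real_sqrt_mult real_sqrt_divide)
  finally have rt: "r * \<bar>real n - 2 * real j\<bar> \<le> 21 * sqrt (real k * real s)" .
  have "\<bar>kraw n s j\<bar> \<le> exp (real n * r\<^sup>2 / 2 + r * \<bar>real n - 2 * real j\<bar>) / r ^ s"
    by (rule abs_kraw_le[OF j r(1)])
  also have "\<dots> \<le> exp (real s / 2 + 21 * sqrt (real k * real s)) / r ^ s"
    using rt r n by (intro divide_right_mono) auto
  finally have "(kraw n s j)\<^sup>2 \<le> (exp (real s / 2 + 21 * sqrt (real k * real s)) / r ^ s)\<^sup>2"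
    using r(1) by (simp flip: abs_le_square_iff)
  also have "\<dots> = exp (real s + 42 * sqrt (real k * real s)) * (real n / real s) ^ s"
  proof -
    have "(r ^ s)\<^sup>2 = (real s / real n) ^ s" by (metis r(2) power_mult mult.commute)
    moreover have "(exp (real s / 2 + 21 * sqrt (real k * real s)))\<^sup>2 = exp (real s + 42 * sqrt (real k * real s))"
      by (simp flip: exp_double)
    ultimately show ?thesis by (simp add: power_divide)
  qed
  finally have K: "(kraw n s j)\<^sup>2 \<le> exp (real s + 42 * sqrt (real k * real s)) * (real n / real s) ^ s" .
  \<comment> \<open>The factor \<open>2 ^ s\<close> comes from \<open>n - s \<ge> n / 2\<close>, the
    constant \<open>exp 2\<close> from \<open>(1 + 1 / s) ^ (2 * s)\<close>.\<close>
  have C: "2 ^ s * real n ^ (2 * s) \<le> (real (n choose s))\<^sup>2 * (exp 2 * real s ^ (2 * s))"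
  proof -
    have "2 ^ s * real n ^ (2 * s) = (real n * (real n / 2)) ^ s * 4 ^ s"
    proof -
      have "2 ^ s * real n ^ (2 * s) = (2 * (real n)\<^sup>2) ^ s"
        by (simp only: power_mult_distrib power_mult)
      also have "2 * (real n)\<^sup>2 = real n * (real n / 2) * 4" by (simp add: power2_eq_square)
      finally show ?thesis by (simp only: power_mult_distrib)
    qed
    also have "\<dots> \<le> (real n * real (n - s)) ^ s * 4 ^ s"
      using s by (intro mult_right_mono power_mono mult_left_mono) auto
    also have "\<dots> \<le> (real (n choose s))\<^sup>2 * (real s + 1) ^ (2 * s)"
      using s by (intro binomial_square_lower_bound) auto
    also have "(real s + 1) ^ (2 * s) = (1 + 1 / real s) ^ (2 * s) * real s ^ (2 * s)"
      using s by (simp add: field_simps flip: power_mult_distrib)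
    also have "(1 + 1 / real s) ^ (2 * s) \<le> exp (1 / real s) ^ (2 * s)"
      by (intro power_mono) auto
    also have "exp (1 / real s) ^ (2 * s) = exp 2"
      using s by (simp flip: exp_of_nat_mult)
    finally show ?thesis by (simp add: mult_left_mono mult_right_mono)
  qed
  have Cpos: "(real (n choose s))\<^sup>2 > 0" using s by simp
  have "(kraw n s j / real (n choose s))\<^sup>2 \<le> exp (real s + 42 * sqrt (real k * real s)) * (real n / real s) ^ s
      / (real (n choose s))\<^sup>2"
    unfolding power_divide by (rule divide_right_mono[OF K[unfolded power_divide]]) simp
  also have "\<dots> \<le> exp (real s + 42 * sqrt (real k * real s)) * (real n / real s) ^ s
      / (2 ^ s * real n ^ (2 * s) / (exp 2 * real s ^ (2 * s)))"
    using C Cpos s n by (intro divide_left_mono) (auto simp: field_simps intro!: mult_pos_pos)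
  also have "\<dots> = (real s / (2 * real n)) ^ s * exp (2 + real s + 42 * sqrt (real k * real s))"
  proof -
    have sq: "x ^ (2 * s) = x ^ s * x ^ s" for x :: real by (simp add: mult_2 power_add)
    show ?thesis unfolding sq using s n
      by (simp add: exp_add power_divide power_mult_distrib field_simps)
  qed
  finally show ?thesis .
qed

text \<open>Splitting \<open>4 ^ s\<close> off \<open>(s / (2 * n)) ^ s\<close> leaves the base
  \<open>2 * s / n \<le> 1\<close>, whose exponent may drop to \<open>2 * k\<close>. Since
  \<open>4 ^ s\<close> exceeds \<open>exp s\<close> by a factor exponential in \<open>s\<close>, the
  surplus absorbs both the window term and the replacement of \<open>s\<close> by \<open>k\<close>
  in the base.\<close>

lemma normalized_kraw_le:
  assumes s: "2 * k \<le> s" "2 * s \<le> n" and k: "k > 0" and j: "j \<le> n"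
    and t: "\<bar>real n - 2 * real j\<bar> \<le> 21 * sqrt (real k * real n)"
  shows "\<bar>kraw n s j / real (n choose s)\<bar> \<le> (40 * exp 2206 * real k / real n) ^ k"
proof -
  have n: "n > 0" and s1: "1 \<le> s" using s k by auto
  \<comment> \<open>In essence \<open>e^5 \<le> 3^5 = 243 \<le> 256 = 4^4\<close>, so
    \<open>exp (5/4) \<le> 4\<close>.\<close>
  have "exp (real s) ^ 5 * exp 0 \<le> (256 ^ s :: real)"
  proof -
    have "exp (real s) ^ 5 = (exp 1 ^ 5) ^ s"
      by (simp flip: exp_of_nat_mult power_mult)
    also have "\<dots> \<le> (3 ^ 5) ^ s" using exp_le by (intro power_mono) auto
    also have "\<dots> \<le> 256 ^ s" by (intro power_mono) auto
    finally show ?thesis by simp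
  qed
  then have "exp (5 / 4 * real s) ^ 4 \<le> (4 ^ s) ^ 4"
    by (simp flip: exp_of_nat_mult power_mult) (simp add: power_mult mult.commute[of s])
  then have four: "exp (5 / 4 * real s) \<le> 4 ^ s"
    by (rule power_mono_iff[THEN iffD1, rotated 3]) auto
  have am: "42 * sqrt (real k * real s) \<le> real s / 10 + 4410 * real k"
  proof -
    have "0 \<le> (sqrt (real s) - 210 * sqrt (real k))\<^sup>2" by simp
    also have "\<dots> = real s + 44100 * real k - 420 * sqrt (real k * real s)"
      by (simp add: power2_diff power_mult_distrib real_sqrt_mult)
    finally show ?thesis by simp
  qed
  have z: "(2 * real s / real k) ^ (2 * k) \<le> 40 ^ (2 * k) * exp (real s / 10)"
  proof -
    have "real s / (20 * real k) \<le> exp (real s / (20 * real k))"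
      using exp_ge_add_one_self[of "real s / (20 * real k)"] by linarith
    then have "2 * real s / real k \<le> 40 * exp (real s / (20 * real k))" using k by (simp add: field_simps)
    then have "(2 * real s / real k) ^ (2 * k) \<le> (40 * exp (real s / (20 * real k))) ^ (2 * k)"
      by (intro power_mono) auto
    also have "\<dots> = 40 ^ (2 * k) * exp (real s / 10)"
      using k by (simp add: power_mult_distrib flip: exp_of_nat_mult)
    finally show ?thesis .
  qed
  have "(real s / (2 * real n)) ^ s = (2 * real s / real n) ^ s / 4 ^ s"
    by (simp add: flip: power_divide)
  also have "\<dots> \<le> (2 * real s / real n) ^ (2 * k) / exp (5 / 4 * real s)"
    using s n four by (intro frac_le power_decreasing) auto
  also have "\<dots> = (real k / real n) ^ (2 * k) * (2 * real s / real k) ^ (2 * k) / exp (5 / 4 * real s)"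
    using k by (simp flip: power_mult_distrib)
  also have "\<dots> \<le> (real k / real n) ^ (2 * k) * (40 ^ (2 * k) * exp (real s / 10)) / exp (5 / 4 * real s)"
    using z by (intro divide_right_mono mult_left_mono) auto
  finally have pow: "(real s / (2 * real n)) ^ s
      \<le> (real k / real n) ^ (2 * k) * (40 ^ (2 * k) * exp (real s / 10)) / exp (5 / 4 * real s)" .
  have "(kraw n s j / real (n choose s))\<^sup>2
      \<le> (real s / (2 * real n)) ^ s * exp (2 + real s + 42 * sqrt (real k * real s))"
    by (rule normalized_kraw_square_le[OF s1 s(2) j t])
  also have "\<dots> \<le> (real k / real n) ^ (2 * k) * (40 ^ (2 * k) * exp (real s / 10)) / exp (5 / 4 * real s)
      * exp (2 + real s + 42 * sqrt (real k * real s))"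
    by (rule mult_right_mono[OF pow]) simp
  also have "\<dots> = (real k / real n) ^ (2 * k) * 40 ^ (2 * k) * exp (2 + 42 * sqrt (real k * real s) - 3 / 20 * real s)"
  proof -
    have "exp (real s / 10) / exp (5 / 4 * real s) * exp (2 + real s + q) = exp (2 + q - 3 / 20 * real s)" for q
      by (simp flip: exp_diff exp_add)
    from this[of "42 * sqrt (real k * real s)"] show ?thesis
      by (metis (no_types) mult.assoc times_divide_eq_right)
  qed
  \<comment> \<open>The window term costs \<open>s / 10 + 4410 * k\<close>, and
    \<open>s / 10\<close> is covered by \<open>3 / 20 * s\<close>. The rest is
    \<open>2 + 4410 * k \<le> 4412 * k = 2206 * (2 * k)\<close>.\<close>
  also have "\<dots> \<le> (real k / real n) ^ (2 * k) * 40 ^ (2 * k) * exp (2206 * real (2 * k))"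
    using am k by (intro mult_left_mono) auto
  also have "\<dots> = ((40 * exp 2206 * real k / real n) ^ k)\<^sup>2"
  proof -
    have "exp (2206 * real (2 * k)) = exp 2206 ^ (2 * k)" by (simp add: mult.commute flip: exp_of_nat_mult)
    then show ?thesis by (simp add: power_mult_distrib power_divide mult.commute[of 2] flip: power_mult)
  qed
  finally show ?thesis by (subst (asm) power2_le_iff_abs_le) simp_all
qed

subsection \<open>Linear systems\<close>

text \<open>Gaussian elimination by induction on the equations: a nonzero coefficient
  \<open>a i l\<close> eliminates the unknown \<open>l\<close> from the other equations, and back
  substitution recovers it.\<close>

lemma underdetermined_system_nontrivial_solution:
  fixes a :: "'i \<Rightarrow> 'j \<Rightarrow> real"
  assumes "finite I" "finite J" "card I < card J"
  shows "\<exists>c. (\<exists>j\<in>J. c j \<noteq> 0) \<and> (\<forall>i\<in>I. (\<Sum>j\<in>J. a i j * c j) = 0)"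
  using assms
proof (induction I arbitrary: J a)
  case empty
  then show ?case by (intro exI[of _ "\<lambda>_. 1"]) (auto simp: card_gt_0_iff)
next
  case (insert i I)
  show ?case
  proof (cases "\<forall>j\<in>J. a i j = 0")
    case True
    obtain c where "\<exists>j\<in>J. c j \<noteq> 0" "\<forall>i\<in>I. (\<Sum>j\<in>J. a i j * c j) = 0"
      using insert.IH[of J a] insert.prems insert.hyps by auto
    then show ?thesis using True by (intro exI[of _ c]) auto
  next
    case False
    then obtain l where l: "l \<in> J" "a i l \<noteq> 0" by blast
    define a' where "a' i' j = a i' j - a i' l * a i j / a i l" for i' j
    have "card I < card (J - {l})"
      using insert.prems insert.hyps l by (simp add: card_Diff_singleton)
    then obtain c where c: "\<exists>j\<in>J - {l}. c j \<noteq> 0" "\<forall>i\<in>I. (\<Sum>j\<in>J - {l}. a' i j * c j) = 0"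
      using insert.IH[of "J - {l}" a'] insert.prems by auto
    define v where "v = (\<Sum>j\<in>J - {l}. a i j * c j)"
    define c' where "c' = c(l := - v / a i l)"
    have split: "(\<Sum>j\<in>J. a i' j * c' j) = - a i' l * v / a i l + (\<Sum>j\<in>J - {l}. a i' j * c j)" for i'
      using insert.prems l by (subst sum.remove[of _ l]) (auto simp: c'_def)
    have "(\<Sum>j\<in>J. a i' j * c' j) = 0" if "i' \<in> I" for i'
    proof -
      have "0 = (\<Sum>j\<in>J - {l}. a' i' j * c j)" using c that by simp
      also have "\<dots> = (\<Sum>j\<in>J - {l}. a i' j * c j - a i' l / a i l * (a i j * c j))"
        by (intro sum.cong) (auto simp: a'_def field_simps)
      also have "\<dots> = (\<Sum>j\<in>J - {l}. a i' j * c j) - a i' l / a i l * v"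
        by (simp add: sum_subtractf sum_distrib_left v_def)
      finally show ?thesis using split[of i'] by simp
    qed
    moreover have "(\<Sum>j\<in>J. a i j * c' j) = 0"
      using split[of i] l by (simp flip: v_def)
    moreover have "\<exists>j\<in>J. c' j \<noteq> 0" using c(1) by (auto simp: c'_def)
    ultimately show ?thesis by (intro exI[of _ c']) auto
  qed
qed

text \<open>Since \<open>E\<close> has row sums at most 1/2 in absolute value, an a priori bound in
  the maximum norm holds. Existence follows by homogenizing: an extra unknown multiplies
  \<open>b\<close>, a nontrivial solution exists by counting, and the bound shows that the extra
  unknown is nonzero.\<close>

lemma perturbed_identity_solvable:
  fixes E :: "'i \<Rightarrow> 'i \<Rightarrow> real"
  assumes T: "finite T" and E: "\<And>s t. s \<in> T \<Longrightarrow> t \<in> T \<Longrightarrow> \<bar>E s t\<bar> \<le> \<delta>"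
    and \<delta>: "real (card T) * \<delta> \<le> 1 / 2" and b: "\<And>s. s \<in> T \<Longrightarrow> \<bar>b s\<bar> \<le> \<beta>"
  shows "\<exists>x. \<forall>s\<in>T. x s = b s + (\<Sum>t\<in>T. E s t * x t) \<and> \<bar>x s\<bar> \<le> 2 * \<beta>"
proof -
  \<comment> \<open>The scalar \<open>y\<close> serves two cases: \<open>y = 0\<close> forces the
    solution to vanish, and \<open>y = 1\<close> gives the final estimate.\<close>
  have bound: "\<bar>x s\<bar> \<le> 2 * \<bar>y\<bar> * \<beta>"
    if x: "\<forall>s\<in>T. x s = y * b s + (\<Sum>t\<in>T. E s t * x t)" and s: "s \<in> T" for x y s
  proof -
    define m where "m = Max ((\<lambda>s. \<bar>x s\<bar>) ` T)"
    have le: "\<bar>x t\<bar> \<le> m" if "t \<in> T" for t using T that by (simp add: m_def)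
    have "m \<in> (\<lambda>s. \<bar>x s\<bar>) ` T" unfolding m_def using T s by (intro Max_in) auto
    then obtain s' where s': "s' \<in> T" "m = \<bar>x s'\<bar>" by blast
    have "\<bar>\<Sum>t\<in>T. E s' t * x t\<bar> \<le> (\<Sum>t\<in>T. \<bar>E s' t * x t\<bar>)" by (rule sum_abs)
    also have "\<dots> \<le> (\<Sum>t\<in>T. \<delta> * m)"
      using E[OF s'(1)] le by (intro sum_mono) (auto simp: abs_mult intro!: mult_mono intro: order_trans[OF abs_ge_zero])
    also have "\<dots> = (real (card T) * \<delta>) * m" by simp
    also have "\<dots> \<le> 1 / 2 * m" using \<delta> s'(2) by (intro mult_right_mono) auto
    finally have "\<bar>\<Sum>t\<in>T. E s' t * x t\<bar> \<le> 1 / 2 * m" .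
    moreover have "\<bar>y * b s'\<bar> \<le> \<bar>y\<bar> * \<beta>"
      using b[OF s'(1)] by (simp add: abs_mult mult_left_mono)
    moreover have "m \<le> \<bar>y * b s'\<bar> + \<bar>\<Sum>t\<in>T. E s' t * x t\<bar>"
      using x s' by (metis abs_triangle_ineq)
    ultimately have "m \<le> 2 * \<bar>y\<bar> * \<beta>" by simp
    then show ?thesis using le[OF s] by simp
  qed
  define a where "a s j = (case j of None \<Rightarrow> - b s | Some t \<Rightarrow> (if s = t then 1 else 0) - E s t)" for s j
  have "card T < card (insert None (Some ` T))"
    using T by (simp add: card_image)
  then obtain c where c: "\<exists>j\<in>insert None (Some ` T). c j \<noteq> 0"
      "\<forall>s\<in>T. (\<Sum>j\<in>insert None (Some ` T). a s j * c j) = 0"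
    using underdetermined_system_nontrivial_solution[of T "insert None (Some ` T)" a] T by auto
  define x where "x t = c (Some t)" for t
  have x: "\<forall>s\<in>T. x s = c None * b s + (\<Sum>t\<in>T. E s t * x t)"
  proof
    fix s assume s: "s \<in> T"
    have "0 = (\<Sum>j\<in>insert None (Some ` T). a s j * c j)" using c(2) s by simp
    also have "\<dots> = - b s * c None + (\<Sum>t\<in>T. ((if s = t then 1 else 0) - E s t) * x t)"
      using T by (subst sum.insert) (auto simp: a_def x_def sum.reindex)
    also have "(\<Sum>t\<in>T. ((if s = t then 1 else 0) - E s t) * x t)
        = (\<Sum>t\<in>T. (if s = t then x t else 0) - E s t * x t)"
      by (intro sum.cong) (auto simp: algebra_simps)
    also have "\<dots> = x s - (\<Sum>t\<in>T. E s t * x t)"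
      using T s by (simp add: sum_subtractf)
    finally show "x s = c None * b s + (\<Sum>t\<in>T. E s t * x t)" by (simp add: algebra_simps)
  qed
  have nz: "c None \<noteq> 0"
  proof
    assume 0: "c None = 0"
    have "x s = 0" if "s \<in> T" for s using bound[OF x that] 0 by simp
    then show False using c(1) 0 by (auto simp: x_def)
  qed
  define z where "z t = x t / c None" for t
  have "\<forall>s\<in>T. z s = 1 * b s + (\<Sum>t\<in>T. E s t * z t)"
  proof
    fix s assume "s \<in> T"
    then have "x s / c None = (c None * b s + (\<Sum>t\<in>T. E s t * x t)) / c None" using x by simp
    then show "z s = 1 * b s + (\<Sum>t\<in>T. E s t * z t)"
      using nz by (simp add: z_def add_divide_distrib sum_divide_distrib)
  qed
  with bound[OF this] show ?thesis by (intro exI[of _ z]) auto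
qed

text \<open>While the support is larger than the number of equations, some nonzero kernel vector
  lives on it. Moving along this vector until a coordinate reaches 0 keeps all equations and shrinks
  the support.\<close>

lemma nonneg_solution_small_support:
  fixes a :: "'i \<Rightarrow> 'j \<Rightarrow> real"
  assumes I: "finite I" and J: "finite J" and p: "\<And>j. j \<in> J \<Longrightarrow> p j \<ge> 0"
  shows "\<exists>q. (\<forall>j\<in>J. q j \<ge> 0) \<and> (\<forall>j\<in>J. p j = 0 \<longrightarrow> q j = 0) \<and>
    (\<forall>i\<in>I. (\<Sum>j\<in>J. a i j * q j) = (\<Sum>j\<in>J. a i j * p j)) \<and> card {j\<in>J. q j \<noteq> 0} \<le> card I"
  using p
proof (induction "card {j\<in>J. p j \<noteq> 0}" arbitrary: p rule: less_induct)
  case less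
  define K where "K = {j\<in>J. p j \<noteq> 0}"
  have K: "finite K" "K \<subseteq> J" using J by (auto simp: K_def)
  have pos: "p j > 0" if "j \<in> K" for j using that less.prems[of j] by (auto simp: K_def)
  show ?case
  proof (cases "card K \<le> card I")
    case True
    then show ?thesis using less.prems by (intro exI[of _ p]) (auto simp: K_def)
  next
    case False
    then obtain c0 where c0: "\<exists>j\<in>K. c0 j \<noteq> 0" "\<forall>i\<in>I. (\<Sum>j\<in>K. a i j * c0 j) = 0"
      using underdetermined_system_nontrivial_solution[OF I K(1), of a] by auto
    obtain c where c: "\<exists>j\<in>K. c j > 0" "\<forall>i\<in>I. (\<Sum>j\<in>K. a i j * c j) = 0"
    proof (cases "\<exists>j\<in>K. c0 j > 0")
      case True
      then show ?thesis using that c0 by blast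
    next
      case False
      then have "\<exists>j\<in>K. - c0 j > 0" using c0(1) by (metis linorder_neqE_linordered_idom neg_0_less_iff_less)
      then show ?thesis using c0 by (intro that[of "\<lambda>j. - c0 j"]) (auto simp: sum_negf)
    qed
    define P where "P = {j\<in>K. c j > 0}"
    have P: "finite P" "P \<noteq> {}" using K c by (auto simp: P_def)
    \<comment> \<open>The largest step that keeps all coordinates nonnegative; the index attaining
      the minimum leaves the support.\<close>
    define \<theta> where "\<theta> = Min ((\<lambda>j. p j / c j) ` P)"
    have "\<theta> \<in> (\<lambda>j. p j / c j) ` P" unfolding \<theta>_def using P by (intro Min_in) auto
    then obtain l where l: "l \<in> P" "\<theta> = p l / c l" by blast
    have \<theta>_pos: "\<theta> > 0" using l pos by (auto simp: P_def)
    have \<theta>_le: "\<theta> * c j \<le> p j" if "j \<in> K" for j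
    proof (cases "c j > 0")
      case True
      then have "\<theta> \<le> p j / c j" unfolding \<theta>_def using P(1) that by (intro Min_le) (auto simp: P_def)
      then show ?thesis using True by (simp add: field_simps)
    next
      case False
      then have "\<theta> * c j \<le> 0" using \<theta>_pos by (simp add: mult_le_0_iff)
      then show ?thesis using pos[OF that] by simp
    qed
    define p' where "p' j = (if j \<in> K then p j - \<theta> * c j else 0)" for j
    have p'_nonneg: "p' j \<ge> 0" for j using \<theta>_le by (auto simp: p'_def)
    have "p' l = 0" using l by (auto simp: p'_def P_def)
    moreover have "l \<in> {j\<in>J. p j \<noteq> 0}" using l(1) by (simp add: P_def K_def)
    moreover have "{j\<in>J. p' j \<noteq> 0} \<subseteq> {j\<in>J. p j \<noteq> 0}" by (auto simp: K_def p'_def)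
    ultimately have "{j\<in>J. p' j \<noteq> 0} \<subset> {j\<in>J. p j \<noteq> 0}" by blast
    then have "card {j\<in>J. p' j \<noteq> 0} < card {j\<in>J. p j \<noteq> 0}"
      using J by (intro psubset_card_mono) auto
    from less.hyps[OF this p'_nonneg] obtain q where q: "\<forall>j\<in>J. q j \<ge> 0"
      "\<forall>j\<in>J. p' j = 0 \<longrightarrow> q j = 0" "\<forall>i\<in>I. (\<Sum>j\<in>J. a i j * q j) = (\<Sum>j\<in>J. a i j * p' j)"
      "card {j\<in>J. q j \<noteq> 0} \<le> card I" by blast
    have "(\<Sum>j\<in>J. a i j * p' j) = (\<Sum>j\<in>J. a i j * p j)" if "i \<in> I" for i
    proof -
      have "(\<Sum>j\<in>J. a i j * p' j) = (\<Sum>j\<in>K. a i j * p' j)"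
        using K J by (intro sum.mono_neutral_right) (auto simp: p'_def)
      also have "\<dots> = (\<Sum>j\<in>K. a i j * p j - \<theta> * (a i j * c j))"
        by (intro sum.cong) (auto simp: p'_def algebra_simps)
      also have "\<dots> = (\<Sum>j\<in>K. a i j * p j)"
        using c(2) that by (simp add: sum_subtractf flip: sum_distrib_left)
      also have "\<dots> = (\<Sum>j\<in>J. a i j * p j)"
        using K J by (intro sum.mono_neutral_left) (auto simp: K_def)
      finally show ?thesis .
    qed
    moreover have "p' j = 0" if "j \<in> J" "p j = 0" for j using that by (simp add: p'_def K_def)
    ultimately show ?thesis using q by (intro exI[of _ q]) auto
  qed
qed

subsection \<open>Weights on the window\<close>

text \<open>A cruder form of \<open>cosh x \<le> exp (x^2 / 2)\<close>. For
  \<open>0 \<le> y \<le> 1\<close> the linear terms of quadratic bounds on \<open>exp y\<close> and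
  \<open>exp (- y)\<close> cancel; for larger \<open>y\<close>, \<open>y \<le> y^2\<close>.\<close>

lemma cosh_le_exp_square: "(exp x + exp (- x)) / 2 \<le> exp (x\<^sup>2)" for x :: real
proof -
  have *: "(exp y + exp (- y)) / 2 \<le> exp (y\<^sup>2)" if y: "y \<ge> 0" for y :: real
  proof (cases "y \<le> 1")
    case True
    have "(1 - y + y\<^sup>2) * (1 + y) = 1 + y ^ 3" by (simp add: power2_eq_square power3_eq_cube algebra_simps)
    then have "1 / (1 + y) \<le> 1 - y + y\<^sup>2" using y by (simp add: pos_divide_le_eq)
    moreover have "exp (- y) \<le> 1 / (1 + y)"
      using y exp_ge_add_one_self[of y] by (simp add: exp_minus inverse_eq_divide frac_le)
    moreover have "exp y \<le> 1 + y + y\<^sup>2" using exp_bound[OF y True] .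
    ultimately have "(exp y + exp (- y)) / 2 \<le> 1 + y\<^sup>2" by simp
    then show ?thesis using exp_ge_add_one_self[of "y\<^sup>2"] by linarith
  next
    case False
    then have "y \<le> y\<^sup>2" using y by (simp add: power2_eq_square)
    then have "exp y \<le> exp (y\<^sup>2)" "exp (- y) \<le> exp (y\<^sup>2)" using y by auto
    then show ?thesis by argo
  qed
  show ?thesis using *[of "\<bar>x\<bar>"] by (cases "x \<ge> 0") (auto simp: add.commute)
qed

lemma binomial_exponential_moment:
  "(\<Sum>j\<le>n. real (n choose j) * exp (x * \<bar>real n - 2 * real j\<bar>)) \<le> 2 * 2 ^ n * exp (real n * x\<^sup>2)"
proof -
  have one: "(\<Sum>j\<le>n. real (n choose j) * exp (y * (real n - 2 * real j))) \<le> 2 ^ n * exp (real n * y\<^sup>2)" for y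
  proof -
    have "(\<Sum>j\<le>n. real (n choose j) * exp (y * (real n - 2 * real j)))
        = (\<Sum>j\<le>n. real (n choose j) * exp (- y) ^ j * exp y ^ (n - j))"
      by (intro sum.cong)
        (auto simp: of_nat_diff algebra_simps simp flip: exp_of_nat_mult exp_add)
    also have "\<dots> = (exp (- y) + exp y) ^ n" by (simp add: binomial_ring)
    also have "\<dots> = 2 ^ n * ((exp y + exp (- y)) / 2) ^ n" by (simp add: power_divide add.commute)
    also have "\<dots> \<le> 2 ^ n * exp (y\<^sup>2) ^ n"
      by (intro mult_left_mono power_mono cosh_le_exp_square) (auto intro: add_nonneg_nonneg)
    finally show ?thesis by (simp flip: exp_of_nat_mult)
  qed
  have "(\<Sum>j\<le>n. real (n choose j) * exp (x * \<bar>real n - 2 * real j\<bar>))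
      \<le> (\<Sum>j\<le>n. real (n choose j) * exp (x * (real n - 2 * real j))
          + real (n choose j) * exp (- x * (real n - 2 * real j)))"
  proof (rule sum_mono)
    fix j
    have "exp (x * \<bar>y\<bar>) \<le> exp (x * y) + exp (- x * y)" for y
      by (cases "y \<ge> 0") auto
    then show "real (n choose j) * exp (x * \<bar>real n - 2 * real j\<bar>)
        \<le> real (n choose j) * exp (x * (real n - 2 * real j)) + real (n choose j) * exp (- x * (real n - 2 * real j))"
      unfolding distrib_left[symmetric] by (intro mult_left_mono) auto
  qed
  also have "\<dots> \<le> 2 ^ n * exp (real n * x\<^sup>2) + 2 ^ n * exp (real n * (- x)\<^sup>2)"
    unfolding sum.distrib by (intro add_mono one)
  finally show ?thesis by simp
qed

text \<open>A Chernoff bound. The exponential weight is the bound on a product of two orthonormal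
  Krawtchouk values at levels near 0 or \<open>n\<close>, so this controls the Gram matrix entries
  lost by truncation.\<close>

lemma binomial_exponential_tail:
  fixes k :: nat
  assumes n: "n > 0"
  defines "l \<equiv> sqrt (real k / real n)"
  shows "(\<Sum>j | j \<le> n \<and> \<bar>real n - 2 * real j\<bar> > 21 * sqrt (real k * real n).
      real (n choose j) / 2 ^ n * exp (4 * real k + 2 * l * \<bar>real n - 2 * real j\<bar>)) \<le> 2 * exp (- 64 * real k)"
    (is "sum ?f ?B \<le> _")
proof -
  have l: "l \<ge> 0" "real n * (10 * l)\<^sup>2 = 100 * real k" "l * sqrt (real k * real n) = real k"
    using n by (auto simp: l_def power_mult_distrib real_sqrt_mult real_sqrt_divide power_divide)
  \<comment> \<open>Outside the window \<open>l * |n - 2j|\<close> is at least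
    \<open>21 * k\<close>, so raising the slope from \<open>2 * l\<close> to \<open>10 * l\<close>
    gains \<open>168 * k\<close> and turns \<open>4 * k\<close> into \<open>- 164 * k\<close>. The
    moment at \<open>10 * l\<close> costs \<open>100 * k\<close>, leaving
    \<open>- 64 * k\<close>.\<close>
  have "sum ?f ?B \<le> (\<Sum>j\<in>?B. exp (- 164 * real k) / 2 ^ n * (real (n choose j) * exp (10 * l * \<bar>real n - 2 * real j\<bar>)))"
  proof (rule sum_mono)
    fix j assume "j \<in> ?B"
    then have "l * (21 * sqrt (real k * real n)) \<le> l * \<bar>real n - 2 * real j\<bar>"
      using l by (intro mult_left_mono) auto
    then have "21 * real k \<le> l * \<bar>real n - 2 * real j\<bar>" using l(3) by simp
    then have "exp (4 * real k + 2 * l * \<bar>real n - 2 * real j\<bar>)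
        \<le> exp (- 164 * real k + 10 * l * \<bar>real n - 2 * real j\<bar>)" by simp
    then have "?f j \<le> real (n choose j) / 2 ^ n * exp (- 164 * real k + 10 * l * \<bar>real n - 2 * real j\<bar>)"
      by (intro mult_left_mono) auto
    also have "\<dots> = exp (- 164 * real k) / 2 ^ n * (real (n choose j) * exp (10 * l * \<bar>real n - 2 * real j\<bar>))"
      unfolding exp_add by simp
    finally show "?f j \<le> \<dots>" .
  qed
  also have "\<dots> \<le> (\<Sum>j\<le>n. exp (- 164 * real k) / 2 ^ n * (real (n choose j) * exp (10 * l * \<bar>real n - 2 * real j\<bar>)))"
    by (intro sum_mono2) auto
  also have "\<dots> \<le> exp (- 164 * real k) / 2 ^ n * (2 * 2 ^ n * exp (real n * (10 * l)\<^sup>2))"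
    unfolding sum_distrib_left[symmetric] by (intro mult_left_mono binomial_exponential_moment) auto
  also have "\<dots> = 2 * (exp (- 164 * real k) * exp (100 * real k))"
    unfolding l(2) by simp
  also have "\<dots> = 2 * exp (- 64 * real k)" by (simp flip: exp_add)
  finally show ?thesis .
qed

text \<open>One radius \<open>sqrt (k / n)\<close> serves all levels \<open>s \<le> 2 * k\<close>:
  the square root of the binomial coefficient is at least \<open>(n / (2 * k)) ^ (s / 2)\<close>,
  which cancels the radius power up to \<open>sqrt 2 ^ s \<le> exp k\<close>. The top levels follow
  by complementation.\<close>

lemma orthonormal_kraw_le:
  assumes k: "k > 0" and j: "j \<le> n" and s: "s \<le> n" "s \<le> 2 * k \<or> n - s \<le> 2 * k"
  shows "\<bar>kraw n s j / sqrt (real (n choose s))\<bar>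
    \<le> exp (2 * real k + sqrt (real k / real n) * \<bar>real n - 2 * real j\<bar>)"
proof -
  define l where "l = sqrt (real k / real n)"
  have *: "\<bar>kraw n s j / sqrt (real (n choose s))\<bar> \<le> exp (2 * real k + l * \<bar>real n - 2 * real j\<bar>)"
    if s: "s \<le> n" "s \<le> 2 * k" for s
  proof (cases "s = 0")
    case True
    have "l \<ge> 0" by (simp add: l_def)
    then show ?thesis using True by simp
  next
    case False
    then have n: "n > 0" using s by simp
    have l: "l > 0" "l\<^sup>2 = real k / real n" using n k by (auto simp: l_def)
    have "(real n / real (2 * k)) ^ s \<le> (real n / real s) ^ s"
      using s False n k by (intro power_mono divide_left_mono) auto
    also have "\<dots> \<le> real (n choose s)" by (rule binomial_ge_n_over_k_pow_k[OF s(1)])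
    finally have "(1 / (2 * l\<^sup>2)) ^ s \<le> real (n choose s)" using l by simp
    then have "sqrt ((1 / (2 * l\<^sup>2)) ^ s) \<le> sqrt (real (n choose s))" by simp
    also have "sqrt ((1 / (2 * l\<^sup>2)) ^ s) = 1 / (sqrt 2 ^ s * l ^ s)"
      using l(1) by (simp add: real_sqrt_power real_sqrt_divide real_sqrt_mult power_divide power_mult_distrib)
    finally have C: "1 / (sqrt 2 ^ s * l ^ s) \<le> sqrt (real (n choose s))" .
    have "\<bar>kraw n s j / sqrt (real (n choose s))\<bar> = \<bar>kraw n s j\<bar> / sqrt (real (n choose s))" by simp
    also have "\<dots> \<le> (exp (real n * l\<^sup>2 / 2 + l * \<bar>real n - 2 * real j\<bar>) / l ^ s) / (1 / (sqrt 2 ^ s * l ^ s))"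
      using C l by (intro frac_le abs_kraw_le[OF j]) auto
    also have "\<dots> = exp (real k / 2 + l * \<bar>real n - 2 * real j\<bar>) * sqrt 2 ^ s"
      using l n by simp
    also have "\<dots> \<le> exp (real k / 2 + l * \<bar>real n - 2 * real j\<bar>) * exp (real k)"
    proof (intro mult_left_mono)
      have "sqrt 2 ^ s \<le> sqrt 2 ^ (2 * k)" using s by (intro power_increasing) auto
      also have "\<dots> = 2 ^ k" by (simp add: power_mult)
      also have "\<dots> \<le> exp 1 ^ k" using exp_ge_add_one_self[of 1] by (intro power_mono) auto
      also have "\<dots> = exp (real k)" by (simp flip: exp_of_nat_mult)
      finally show "sqrt 2 ^ s \<le> exp (real k)" .
    qed simp
    also have "\<dots> \<le> exp (2 * real k + l * \<bar>real n - 2 * real j\<bar>)" by (simp flip: exp_add)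
    finally show ?thesis .
  qed
  show ?thesis
  proof (cases "s \<le> 2 * k")
    case True
    then show ?thesis using *[of s] s by (simp add: l_def)
  next
    case False
    then show ?thesis using *[of "n - s"] s abs_kraw_complement[OF s(1) j]
      by (simp add: l_def binomial_symmetric[OF s(1)])
  qed
qed

text \<open>Truncating the binomial weights to the window \<open>|n - 2j| \<le> 21 * sqrt (k * n)\<close> perturbs the
  Gram matrix of the orthonormal Krawtchouk polynomials by at most \<open>\<delta>\<close> per entry. Multiplying the
  truncated weights by \<open>1 + \<Sum> b\<^sub>t \<psi>\<^sub>t\<close>, where \<open>b\<close> solves a perturbed identity system, restores the
  moments, and the correction is too small to destroy nonnegativity.\<close>

lemma window_weights:
  assumes n: "n > 0" and k: "k > 0"
  shows "\<exists>p. (\<forall>j\<le>n. p j \<ge> 0) \<and> (\<forall>j\<le>n. p j \<noteq> 0 \<longrightarrow> \<bar>real n - 2 * real j\<bar> \<le> 21 * sqrt (real k * real n)) \<and>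
    card {j\<in>{..n}. p j \<noteq> 0} \<le> 4 * k + 2 \<and>
    (\<forall>s\<le>n. s \<le> 2 * k \<or> n - s \<le> 2 * k \<longrightarrow> (\<Sum>j\<le>n. kraw n s j * p j) = (if s = 0 then 1 else 0))"
proof -
  \<comment> \<open>The levels whose moments are prescribed. Level 0 belongs to them; its equation
    says that the total mass is 1.\<close>
  define T where "T = {s. s \<le> n \<and> (s \<le> 2 * k \<or> n - s \<le> 2 * k)}"
  define l where "l = sqrt (real k / real n)"
  define \<psi> where "\<psi> s j = kraw n s j / sqrt (real (n choose s))" for s j
  define \<mu> where "\<mu> j = real (n choose j) / 2 ^ n" for j
  define t where "t j = \<bar>real n - 2 * real j\<bar>" for j
  define R where "R = 21 * sqrt (real k * real n)"
  define A where "A = {j. j \<le> n \<and> t j \<le> R}"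
  define B where "B = {j. j \<le> n \<and> t j > R}"
  define \<delta> where "\<delta> = 2 * exp (- 64 * real k)"
  \<comment> \<open>The part of the Gram matrix lost outside the window.\<close>
  define E where "E s u = (\<Sum>j\<in>B. \<mu> j * (\<psi> s j * \<psi> u j))" for s u
  have T: "finite T" "0 \<in> T" by (auto simp: T_def)
  have AB: "finite A" "finite B" "A \<inter> B = {}" "A \<union> B = {..n}" by (auto simp: A_def B_def)
  have card_T: "card T \<le> 4 * k + 2"
  proof -
    have "T \<subseteq> {..2 * k} \<union> (\<lambda>i. n - i) ` {..2 * k}"
    proof
      fix s assume "s \<in> T"
      then show "s \<in> {..2 * k} \<union> (\<lambda>i. n - i) ` {..2 * k}"
        by (cases "s \<le> 2 * k") (auto simp: T_def image_iff intro!: bexI[of _ "n - s"])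
    qed
    then have "card T \<le> card ({..2 * k} \<union> (\<lambda>i. n - i) ` {..2 * k})" by (intro card_mono) auto
    also have "\<dots> \<le> card {..2 * k} + card ((\<lambda>i. n - i) ` {..2 * k})" by (rule card_Un_le)
    also have "\<dots> \<le> card {..2 * k} + card {..2 * k}" by (intro add_left_mono card_image_le) simp
    finally show ?thesis by simp
  qed
  have \<mu>: "\<mu> j \<ge> 0" for j by (simp add: \<mu>_def)
  have \<psi>0: "\<psi> 0 j = 1" for j by (simp add: \<psi>_def)
  have \<psi>: "\<bar>\<psi> s j\<bar> \<le> exp (2 * real k + l * t j)" if "s \<in> T" "j \<le> n" for s j
    using orthonormal_kraw_le[OF k that(2), of s] that(1) by (simp add: T_def \<psi>_def l_def t_def)
  have orth: "(\<Sum>j\<le>n. \<mu> j * (\<psi> s j * \<psi> u j)) = (if s = u then 1 else 0)" if "s \<in> T" for s u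
  proof -
    have "(\<Sum>j\<le>n. \<mu> j * (\<psi> s j * \<psi> u j))
        = (\<Sum>j\<le>n. real (n choose j) * (kraw n s j * kraw n u j) / (2 ^ n * (sqrt (real (n choose s)) * sqrt (real (n choose u)))))"
      by (intro sum.cong) (auto simp: \<mu>_def \<psi>_def)
    also have "\<dots> = (if s = u then 1 else 0)"
      unfolding sum_divide_distrib[symmetric] kraw_orthogonal using that by (auto simp: T_def)
    finally show ?thesis .
  qed
  have gram: "(\<Sum>j\<in>A. \<mu> j * (\<psi> s j * \<psi> u j)) = (if s = u then 1 else 0) - E s u" if "s \<in> T" for s u
    using orth[OF that, of u] AB unfolding E_def AB(4)[symmetric] by (simp add: sum.union_disjoint)
  have E: "\<bar>E s u\<bar> \<le> \<delta>" if "s \<in> T" "u \<in> T" for s u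
  proof -
    have "\<bar>E s u\<bar> \<le> (\<Sum>j\<in>B. \<bar>\<mu> j * (\<psi> s j * \<psi> u j)\<bar>)" unfolding E_def by (rule sum_abs)
    also have "\<dots> \<le> (\<Sum>j\<in>B. \<mu> j * exp (4 * real k + 2 * l * t j))"
    proof (rule sum_mono)
      fix j assume "j \<in> B"
      then have j: "j \<le> n" by (simp add: B_def)
      have "\<bar>\<psi> s j\<bar> * \<bar>\<psi> u j\<bar> \<le> exp (2 * real k + l * t j) * exp (2 * real k + l * t j)"
        using \<psi>[OF that(1) j] \<psi>[OF that(2) j] by (intro mult_mono) auto
      also have "\<dots> = exp (4 * real k + 2 * l * t j)" by (simp add: algebra_simps flip: exp_add)
      finally show "\<bar>\<mu> j * (\<psi> s j * \<psi> u j)\<bar> \<le> \<mu> j * exp (4 * real k + 2 * l * t j)"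
        using \<mu>[of j] by (simp add: abs_mult mult_left_mono)
    qed
    also have "\<dots> \<le> \<delta>"
      using binomial_exponential_tail[OF n, of k] by (simp add: B_def \<mu>_def l_def t_def R_def \<delta>_def)
    finally show ?thesis .
  qed
  \<comment> \<open>On the window each \<open>\<psi>\<close> is at most \<open>exp (23 * k)\<close>,
    from \<open>2 * k + 21 * k\<close>, and each \<open>b\<close> will be at most
    \<open>2 * \<delta>\<close>. Hence this keeps the correction at most 1; the rate 64 in
    \<open>\<delta>\<close> leaves ample room.\<close>
  have small: "real (card T) * (2 * \<delta> * exp (23 * real k)) \<le> 1"
  proof -
    have "real (card T) \<le> 6 * real k" using card_T k by linarith
    also have "\<dots> \<le> 6 * exp (real k)" using exp_ge_add_one_self[of "real k"] by linarith
    finally have "real (card T) * (2 * \<delta> * exp (23 * real k)) \<le> 6 * exp (real k) * (2 * \<delta> * exp (23 * real k))"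
      by (intro mult_right_mono) (auto simp: \<delta>_def)
    also have "\<dots> = 24 * (exp (real k) * exp (- 64 * real k) * exp (23 * real k))"
      by (simp add: \<delta>_def)
    also have "\<dots> = 24 * exp (- 40 * real k)"
      unfolding exp_add[symmetric] by simp
    also have "\<dots> = 24 / exp (40 * real k)" by (simp add: exp_minus divide_inverse)
    also have "\<dots> \<le> 1" 
    proof -
      have "24 \<le> 1 + 40 * real k" using k by simp
      also have "\<dots> \<le> exp (40 * real k)" by (rule exp_ge_add_one_self)
      finally show ?thesis by simp
    qed
    finally show ?thesis .
  qed
  have "real (card T) * (2 * \<delta> * 1) \<le> real (card T) * (2 * \<delta> * exp (23 * real k))"
    by (intro mult_left_mono) (auto simp: \<delta>_def)
  from this small have "real (card T) * (2 * \<delta> * 1) \<le> 1" by (rule order_trans)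
  then have "real (card T) * \<delta> \<le> 1 / 2" by simp
  \<comment> \<open>The corrected moments are \<open>(I - E)(e_0 + b)\<close>; requiring them to
    equal \<open>e_0\<close> gives \<open>b = E e_0 + E b\<close>.\<close>
  from perturbed_identity_solvable[of T E \<delta> "\<lambda>s. E s 0", OF T(1) E this E[OF _ T(2)]]
  obtain b where b: "b s = E s 0 + (\<Sum>u\<in>T. E s u * b u)" "\<bar>b s\<bar> \<le> 2 * \<delta>" if "s \<in> T" for s
    by blast
  define f where "f j = 1 + (\<Sum>u\<in>T. b u * \<psi> u j)" for j
  define p where "p j = (if j \<in> A then \<mu> j * f j else 0)" for j
  have f: "f j \<ge> 0" if "j \<in> A" for j
  proof -
    have "l * t j \<le> l * R" using that by (intro mult_left_mono) (auto simp: A_def l_def)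
    also have "\<dots> = 21 * real k"
      using n by (simp add: l_def R_def real_sqrt_mult real_sqrt_divide)
    finally have lt: "2 * real k + l * t j \<le> 23 * real k" by simp
    have "\<bar>\<Sum>u\<in>T. b u * \<psi> u j\<bar> \<le> (\<Sum>u\<in>T. \<bar>b u * \<psi> u j\<bar>)" by (rule sum_abs)
    also have "\<dots> \<le> (\<Sum>u\<in>T. 2 * \<delta> * exp (23 * real k))"
    proof (rule sum_mono)
      fix u assume u: "u \<in> T"
      have "\<bar>\<psi> u j\<bar> \<le> exp (23 * real k)"
        using \<psi>[OF u, of j] that iffD2[OF exp_le_cancel_iff lt]
        unfolding A_def by (blast intro: order_trans)
      then show "\<bar>b u * \<psi> u j\<bar> \<le> 2 * \<delta> * exp (23 * real k)"
        using b(2)[OF u] unfolding abs_mult by (intro mult_mono) (auto simp: \<delta>_def)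
    qed
    also have "\<dots> \<le> 1" using small by simp
    finally show ?thesis unfolding f_def by linarith
  qed
  have moments: "(\<Sum>j\<le>n. kraw n s j * p j) = (if s = 0 then 1 else 0)" if s: "s \<in> T" for s
  proof -
    have "(\<Sum>j\<le>n. \<psi> s j * p j) = (\<Sum>j\<in>A. \<psi> s j * p j)"
      using AB by (intro sum.mono_neutral_right) (auto simp: p_def)
    also have "\<dots> = (\<Sum>j\<in>A. \<mu> j * (\<psi> s j * \<psi> 0 j) + (\<Sum>u\<in>T. b u * (\<mu> j * (\<psi> s j * \<psi> u j))))"
      by (intro sum.cong) (auto simp: p_def f_def \<psi>0 algebra_simps sum_distrib_left)
    also have "\<dots> = (\<Sum>j\<in>A. \<mu> j * (\<psi> s j * \<psi> 0 j)) + (\<Sum>u\<in>T. b u * (\<Sum>j\<in>A. \<mu> j * (\<psi> s j * \<psi> u j)))"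
      unfolding sum.distrib by (subst sum.swap) (simp add: sum_distrib_left)
    also have "\<dots> = (if s = 0 then 1 else 0) - E s 0 + (\<Sum>u\<in>T. b u * ((if s = u then 1 else 0) - E s u))"
      by (simp add: gram[OF s])
    also have "(\<Sum>u\<in>T. b u * ((if s = u then 1 else 0) - E s u)) = (\<Sum>u\<in>T. (if s = u then b u else 0) - E s u * b u)"
      by (intro sum.cong) (auto simp: algebra_simps)
    also have "\<dots> = b s - (\<Sum>u\<in>T. E s u * b u)"
      using T s by (simp add: sum_subtractf)
    finally have "(\<Sum>j\<le>n. \<psi> s j * p j) = (if s = 0 then 1 else 0)" using b(1)[OF s] by simp
    moreover have "(\<Sum>j\<le>n. \<psi> s j * p j) = (\<Sum>j\<le>n. kraw n s j * p j) / sqrt (real (n choose s))"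
      by (simp add: \<psi>_def sum_divide_distrib)
    ultimately show ?thesis using s by (auto simp: T_def split: if_splits)
  qed
  have "p j \<ge> 0" if "j \<in> {..n}" for j using \<mu> f by (simp add: p_def)
  \<comment> \<open>The moment equations at the levels in \<open>T\<close> are the only constraints
    to keep, so the support shrinks to at most \<open>card T\<close> points, all inside the
    window.\<close>
  from nonneg_solution_small_support[of T "{..n}" p "kraw n", OF T(1) _ this]
  obtain q where q: "\<forall>j\<le>n. q j \<ge> 0" "\<forall>j\<le>n. p j = 0 \<longrightarrow> q j = 0"
    "\<forall>s\<in>T. (\<Sum>j\<le>n. kraw n s j * q j) = (\<Sum>j\<le>n. kraw n s j * p j)" "card {j\<in>{..n}. q j \<noteq> 0} \<le> card T"
    by auto
  show ?thesis
  proof (intro exI[of _ q] conjI allI impI)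
    fix j assume "j \<le> n" "q j \<noteq> 0"
    then have "j \<in> A" using q(2) unfolding p_def by metis
    then show "\<bar>real n - 2 * real j\<bar> \<le> 21 * sqrt (real k * real n)" by (simp add: A_def t_def R_def)
  next
    fix s assume "s \<le> n" "s \<le> 2 * k \<or> n - s \<le> 2 * k"
    then show "(\<Sum>j\<le>n. kraw n s j * q j) = (if s = 0 then 1 else 0)"
      using q(3) moments by (simp add: T_def)
  qed (use q card_T in auto)
qed

subsection \<open>Exchangeable distributions\<close>

text \<open>The mass \<open>p j\<close> is spread evenly over the sets \<open>X\<close> of size
  \<open>j\<close>, where \<open>X\<close> is the set of coordinates equal to -1. The expectation of
  a character then involves \<open>kraw n j (card S)\<close>, and reciprocity swaps the two
  arguments.\<close>

lemma exchangeable_distribution: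
  fixes p :: "nat \<Rightarrow> real"
  assumes p: "\<And>j. j \<le> n \<Longrightarrow> p j \<ge> 0" and sum_p: "(\<Sum>j\<le>n. p j) = 1"
  obtains D where "distribution_on_cube n D"
    "\<And>S. S \<subseteq> {1..n} \<Longrightarrow> measure_pmf.expectation D (\<lambda>x. \<Prod>i\<in>S. x i)
      = (\<Sum>j\<le>n. p j * (kraw n (card S) j / real (n choose card S)))"
    "\<And>x. x \<in> set_pmf D \<Longrightarrow> \<exists>j\<le>n. p j \<noteq> 0 \<and> (\<Sum>i=1..n. x i) = real n - 2 * real j"
proof -
  define A where "A = {1..n}"
  have A: "finite A" "card A = n" by (auto simp: A_def)
  define q where "q X = (if X \<subseteq> A then p (card X) / real (n choose card X) else 0)" for X
  have card_le: "card X \<le> n" if "X \<subseteq> A" for X using card_mono[OF A(1) that] A(2) by simp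
  have q_nonneg: "q X \<ge> 0" for X using p card_le by (simp add: q_def)
  have "(\<Sum>X\<in>Pow A. q X) = (\<Sum>X\<in>Pow A. p (card X) / real (n choose card X))"
    by (intro sum.cong) (auto simp: q_def)
  also have "\<dots> = (\<Sum>j\<le>n. real (n choose j) * (p j / real (n choose j)))"
    using sum_Pow_by_card[OF A(1), of "\<lambda>j. p j / real (n choose j)"] A(2) by simp
  also have "\<dots> = (\<Sum>j\<le>n. p j)" by (intro sum.cong) auto
  finally have sum_q: "(\<Sum>X\<in>Pow A. q X) = 1" using sum_p by simp
  have int_q: "(\<integral>\<^sup>+ X. ennreal (q X) \<partial>count_space UNIV) = 1"
  proof -
    have "(\<integral>\<^sup>+ X. ennreal (q X) \<partial>count_space UNIV) = (\<Sum>X\<in>Pow A. ennreal (q X))"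
      using A by (intro nn_integral_count_space') (auto simp: q_def)
    then show ?thesis using q_nonneg sum_q by (simp add: sum_ennreal)
  qed
  define Q where "Q = embed_pmf q"
  have pmf_Q: "pmf Q X = q X" for X
    unfolding Q_def by (rule pmf_embed_pmf[OF q_nonneg int_q])
  have set_Q: "set_pmf Q = {X. q X \<noteq> 0}"
    unfolding Q_def by (rule set_embed_pmf[OF q_nonneg int_q])
  define v :: "nat set \<Rightarrow> nat \<Rightarrow> real" where
    "v X = (\<lambda>i\<in>A. if i \<in> X then - 1 else 1)" for X
  define D where "D = map_pmf v Q"
  show thesis
  proof
    show "distribution_on_cube n D"
      by (auto simp: distribution_on_cube_def D_def cube_def v_def A_def)
  next
    fix S :: "nat set" assume "S \<subseteq> {1..n}"
    then have S: "S \<subseteq> A" by (simp add: A_def)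
    then have "finite S" using A finite_subset by blast
    have vS: "(\<Prod>i\<in>S. v X i) = (- 1) ^ card (X \<inter> S)" for X
    proof -
      have "(\<Prod>i\<in>S. v X i) = (\<Prod>i\<in>S. if i \<in> X then - 1 else 1)"
        using S by (intro prod.cong) (auto simp: v_def)
      then show ?thesis using prod_if_neg_one[OF \<open>finite S\<close>, of X] by (simp add: Int_commute)
    qed
    have "measure_pmf.expectation D (\<lambda>x. \<Prod>i\<in>S. x i)
        = measure_pmf.expectation Q (\<lambda>X. (- 1) ^ card (X \<inter> S))"
      by (simp add: D_def vS)
    also have "\<dots> = (\<Sum>X\<in>Pow A. (- 1) ^ card (X \<inter> S) * q X)"
      using A by (subst integral_measure_pmf_real[of "Pow A"]) (auto simp: set_Q pmf_Q q_def split: if_splits)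
    also have "\<dots> = (\<Sum>j\<le>n. \<Sum>X | X \<subseteq> A \<and> card X = j. (- 1) ^ card (X \<inter> S) * q X)"
      using sum_Pow_group_card[OF A(1), of "\<lambda>X. (- 1) ^ card (X \<inter> S) * q X"] A(2) by simp
    also have "\<dots> = (\<Sum>j\<le>n. p j / real (n choose j) * kraw n j (card S))"
    proof (rule sum.cong)
      fix j
      have "(\<Sum>X | X \<subseteq> A \<and> card X = j. (- 1) ^ card (X \<inter> S) * q X)
          = (\<Sum>X | X \<subseteq> A \<and> card X = j. p j / real (n choose j) * (- 1) ^ card (X \<inter> S))"
        by (intro sum.cong) (auto simp: q_def)
      also have "\<dots> = p j / real (n choose j) * kraw n j (card S)"
        unfolding sum_distrib_left[symmetric] by (simp add: sum_character_card[OF A(1) S] A(2))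
      finally show "(\<Sum>X | X \<subseteq> A \<and> card X = j. (- 1) ^ card (X \<inter> S) * q X)
          = p j / real (n choose j) * kraw n j (card S)" .
    qed simp
    also have "\<dots> = (\<Sum>j\<le>n. p j * (kraw n (card S) j / real (n choose card S)))"
    proof (rule sum.cong)
      fix j assume "j \<in> {..n}"
      then have "real (n choose j) \<noteq> 0" "real (n choose card S) \<noteq> 0" using card_le[OF S] by auto
      then show "p j / real (n choose j) * kraw n j (card S) = p j * (kraw n (card S) j / real (n choose card S))"
        using kraw_reciprocity[of n "card S" j] by (simp add: field_simps)
    qed simp
    finally show "measure_pmf.expectation D (\<lambda>x. \<Prod>i\<in>S. x i)
        = (\<Sum>j\<le>n. p j * (kraw n (card S) j / real (n choose card S)))" .
  next
    fix x assume "x \<in> set_pmf D"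
    then obtain X where X: "q X \<noteq> 0" "x = v X" by (auto simp: D_def set_Q)
    then have XA: "X \<subseteq> A" and "p (card X) \<noteq> 0" by (auto simp: q_def split: if_splits)
    have "(\<Sum>i\<in>A. x i) = (\<Sum>i\<in>A. if i \<in> X then - 1 else 1)"
      by (intro sum.cong) (auto simp: X v_def)
    also have "\<dots> = (\<Sum>i\<in>A. 1 - 2 * (if i \<in> X then 1 else 0))"
      by (intro sum.cong) auto
    also have "\<dots> = real n - 2 * (\<Sum>i\<in>A. if i \<in> X then 1 else 0)"
      using A by (simp add: sum_subtractf sum_distrib_left)
    also have "(\<Sum>i\<in>A. if i \<in> X then 1 else 0) = real (card X)"
      using XA A by (simp add: sum.If_cases Int_absorb1)
    finally show "\<exists>j\<le>n. p j \<noteq> 0 \<and> (\<Sum>i=1..n. x i) = real n - 2 * real j"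
      using card_le[OF XA] \<open>p (card X) \<noteq> 0\<close> unfolding A_def by blast
  qed
qed

section \<open>Bias, number of values and range of the constructed distribution\<close>

theorem mainTheorem4:
  "\<exists>c1 c2 :: real. c1 > 0 \<and> c2 > 0 \<and>
    (\<forall>n k :: nat. n > 0 \<and> k > 0 \<longrightarrow>
      (\<exists>D :: (nat \<Rightarrow> real) pmf.
        distribution_on_cube n D \<and>
        biased n ((c1 * real k / real n) ^ k) D \<and>
        real (card (set_pmf (map_pmf (\<lambda>x. \<Sum>i=1..n. x i) D))) \<le> c2 * (real k)\<^sup>2 \<and>
        (AE x in measure_pmf D. \<bar>\<Sum>i=1..n. x i\<bar> \<le> 21 * sqrt (real k * real n))))"
proof (rule exI[of _ "40 * exp 2206"], rule exI[of _ 6], intro conjI allI impI)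
  fix n k :: nat
  assume "n > 0 \<and> k > 0"
  then have n: "n > 0" and k: "k > 0" by auto
  obtain p where p: "\<And>j. j \<le> n \<Longrightarrow> p j \<ge> 0"
    and window: "\<And>j. j \<le> n \<Longrightarrow> p j \<noteq> 0 \<Longrightarrow> \<bar>real n - 2 * real j\<bar> \<le> 21 * sqrt (real k * real n)"
    and supp: "card {j\<in>{..n}. p j \<noteq> 0} \<le> 4 * k + 2"
    and moments: "\<And>s. s \<le> n \<Longrightarrow> s \<le> 2 * k \<or> n - s \<le> 2 * k \<Longrightarrow>
      (\<Sum>j\<le>n. kraw n s j * p j) = (if s = 0 then 1 else 0)"
    using window_weights[OF n k] by blast
  have sum_p: "(\<Sum>j\<le>n. p j) = 1" using moments[of 0] by simp
  obtain D where D: "distribution_on_cube n D"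
    "\<And>S. S \<subseteq> {1..n} \<Longrightarrow> measure_pmf.expectation D (\<lambda>x. \<Prod>i\<in>S. x i)
      = (\<Sum>j\<le>n. p j * (kraw n (card S) j / real (n choose card S)))"
    "\<And>x. x \<in> set_pmf D \<Longrightarrow> \<exists>j\<le>n. p j \<noteq> 0 \<and> (\<Sum>i=1..n. x i) = real n - 2 * real j"
    using exchangeable_distribution[OF p sum_p] by blast
  have bias: "\<bar>\<Sum>j\<le>n. p j * (kraw n s j / real (n choose s))\<bar> \<le> (40 * exp 2206 * real k / real n) ^ k"
    (is "_ \<le> ?\<epsilon>") if s: "s \<noteq> 0" "s \<le> n" for s
  \<comment> \<open>Levels near 0 or \<open>n\<close> vanish by the moment conditions. At the others
    the coefficient is an average, with weights \<open>p\<close>, of normalized Krawtchouk values on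
    the window, each bounded pointwise.\<close>
  proof (cases "s \<le> 2 * k \<or> n - s \<le> 2 * k")
    case True
    have "(\<Sum>j\<le>n. p j * (kraw n s j / real (n choose s))) = (\<Sum>j\<le>n. kraw n s j * p j) / real (n choose s)"
      by (simp add: sum_divide_distrib mult.commute)
    then show ?thesis using moments[OF s(2) True] s by simp
  next
    case False
    have "\<bar>kraw n s j / real (n choose s)\<bar> \<le> ?\<epsilon>" if j: "j \<le> n" "p j \<noteq> 0" for j
    proof (cases "2 * s \<le> n")
      case True
      then show ?thesis using False by (intro normalized_kraw_le[OF _ True k j(1) window[OF j]]) auto
    next
      case *: False
      have "\<bar>kraw n (n - s) j / real (n choose (n - s))\<bar> \<le> ?\<epsilon>"
        using False * by (intro normalized_kraw_le[OF _ _ k j(1) window[OF j]]) auto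
      then show ?thesis
        using abs_kraw_complement[OF s(2) j(1)] by (simp add: binomial_symmetric[OF s(2)])
    qed
    then have "p j * \<bar>kraw n s j / real (n choose s)\<bar> \<le> p j * ?\<epsilon>" if "j \<le> n" for j
      using p that by (cases "p j = 0") (auto simp del: abs_divide intro!: mult_left_mono)
    then have "\<bar>\<Sum>j\<le>n. p j * (kraw n s j / real (n choose s))\<bar> \<le> (\<Sum>j\<le>n. p j * ?\<epsilon>)"
      using p by (intro order_trans[OF sum_abs] sum_mono) (simp add: abs_mult)
    also have "\<dots> = ?\<epsilon>" using sum_p by (simp flip: sum_distrib_right)
    finally show ?thesis .
  qed
  show "\<exists>D. distribution_on_cube n D \<and> biased n ((40 * exp 2206 * real k / real n) ^ k) D \<and>
        real (card (set_pmf (map_pmf (\<lambda>x. \<Sum>i=1..n. x i) D))) \<le> 6 * (real k)\<^sup>2 \<and>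
        (AE x in measure_pmf D. \<bar>\<Sum>i=1..n. x i\<bar> \<le> 21 * sqrt (real k * real n))"
  proof (intro exI[of _ D] conjI)
    show "distribution_on_cube n D" by fact
    show "biased n ((40 * exp 2206 * real k / real n) ^ k) D"
      unfolding biased_def
    proof (intro allI impI)
      fix S assume S: "S \<subseteq> {1..n} \<and> S \<noteq> {}"
      then have "card S \<noteq> 0" "card S \<le> n"
        using card_mono[of "{1..n}" S] finite_subset[of S "{1..n}"] by auto
      then show "\<bar>measure_pmf.expectation D (\<lambda>x. \<Prod>i\<in>S. x i)\<bar> \<le> (40 * exp 2206 * real k / real n) ^ k"
        using S bias[of "card S"] D(2)[of S] by simp
    qed
    have "set_pmf (map_pmf (\<lambda>x. \<Sum>i=1..n. x i) D) \<subseteq> (\<lambda>j. real n - 2 * real j) ` {j\<in>{..n}. p j \<noteq> 0}"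
      using D(3) by fastforce
    then have "card (set_pmf (map_pmf (\<lambda>x. \<Sum>i=1..n. x i) D)) \<le> card {j\<in>{..n}. p j \<noteq> 0}"
      by (rule surj_card_le[rotated]) simp
    \<comment> \<open>The number of values is even linear in \<open>k\<close>:
      \<open>4 * k + 2 \<le> 6 * k\<close> because \<open>k \<ge> 1\<close>.\<close>
    then have "real (card (set_pmf (map_pmf (\<lambda>x. \<Sum>i=1..n. x i) D))) \<le> 6 * real k"
      using supp k by linarith
    also have "\<dots> \<le> 6 * (real k)\<^sup>2" using k by (simp add: power2_eq_square)
    finally show "real (card (set_pmf (map_pmf (\<lambda>x. \<Sum>i=1..n. x i) D))) \<le> 6 * (real k)\<^sup>2" .
    show "AE x in measure_pmf D. \<bar>\<Sum>i=1..n. x i\<bar> \<le> 21 * sqrt (real k * real n)"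
    proof (rule AE_pmfI)
      fix x assume "x \<in> set_pmf D"
      from D(3)[OF this] show "\<bar>\<Sum>i=1..n. x i\<bar> \<le> 21 * sqrt (real k * real n)"
        using window by auto
    qed
  qed
qed simp_all

end
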